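(* Let $\Gamma$ be a finitely generated nilpotent group. Then $\operatorname{asdim}\Gamma\le h(\Gamma)$, where $h(\Gamma)$ is the Hirsch length of $\Gamma$.
   Context: For a metric space $X$, $\operatorname{asdim} X\le n$ means: for every $D>0$ there exist families $\mathcal{U}_0,\ldots,\mathcal{U}_n$ of uniformly bounded subsets of $X$, each $D$-disjoint (distinct members are at distance $>D$), whose union covers $X$. $\operatorname{asdim}X$ is the smallest such $n$. A finitely generated group carries the word metric of a finite generating set ($\operatorname{asdim}$ does not depend on the choice). Every finitely generated nilpotent group is polycyclic, i.e. has a sequence of subgroups $\{1\}=G_0\subset G_1\subset\cdots\subset G_n=G$ such that each $G_i$ is normal in $G_{i+1}$ and $G_{i+1}/G_i$ is cyclic. The Hirsch length $h(G)$ is the number of factors $G_{i+1}/G_i$ isomorphic to $\mathbb{Z}$. *)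

theory Defs
  imports "HOL-Algebra.Elementary_Groups" "HOL-Analysis.Abstract_Metric_Spaces"
    "HOL-Library.Extended_Nat" "HOL-Library.Extended_Real"
begin

section \<open>Asymptotic dimension\<close>

context Metric_space
begin

text \<open>The distance between two sets is an infimum in \<^typ>\<open>ereal\<close>, so that it is \<open>\<infinity>\<close> if
  one of the sets is empty.\<close>

definition set_distance :: "'a set \<Rightarrow> 'a set \<Rightarrow> ereal" where
  "set_distance A B = (INF x\<in>A. INF y\<in>B. ereal (d x y))"

definition disjoint_family_at :: "real \<Rightarrow> 'a set set \<Rightarrow> bool" where
  "disjoint_family_at D \<U> \<longleftrightarrow> (\<forall>A\<in>\<U>. \<forall>B\<in>\<U>. A \<noteq> B \<longrightarrow> set_distance A B > ereal D)"

definition uniformly_bounded :: "'a set set \<Rightarrow> bool" where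
  "uniformly_bounded \<U> \<longleftrightarrow> (\<exists>R. \<forall>A\<in>\<U>. A \<subseteq> M \<and> (\<forall>x\<in>A. \<forall>y\<in>A. d x y \<le> R))"

definition asdim_le :: "nat \<Rightarrow> bool" where
  "asdim_le n \<longleftrightarrow>
    (\<forall>D>0. \<exists>\<U> :: nat \<Rightarrow> 'a set set.
       (\<forall>i\<le>n. uniformly_bounded (\<U> i) \<and> disjoint_family_at D (\<U> i)) \<and>
       (\<Union>i\<le>n. \<Union>(\<U> i)) = M)"

text \<open>The value is \<open>\<infinity>\<close> if no \<open>n\<close> satisfies the condition.\<close>

definition asdim :: enat where
  "asdim = (INF n\<in>{n. asdim_le n}. enat n)"

end


section \<open>Word metrics\<close>

definition is_word :: "('a, 'b) monoid_scheme \<Rightarrow> 'a set \<Rightarrow> 'a list \<Rightarrow> bool" where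
  "is_word G S ws \<longleftrightarrow> set ws \<subseteq> S \<union> m_inv G ` S"

definition word_value :: "('a, 'b) monoid_scheme \<Rightarrow> 'a list \<Rightarrow> 'a" where
  "word_value G ws = foldr (mult G) ws \<one>\<^bsub>G\<^esub>"

definition word_length :: "('a, 'b) monoid_scheme \<Rightarrow> 'a set \<Rightarrow> 'a \<Rightarrow> nat" where
  "word_length G S g = (LEAST n. \<exists>ws. is_word G S ws \<and> word_value G ws = g \<and> length ws = n)"

text \<open>The value \<open>0\<close> off the carrier is needed because \<^locale>\<open>Metric_space\<close> demands symmetry of
  the distance on the whole type.\<close>

definition word_dist :: "('a, 'b) monoid_scheme \<Rightarrow> 'a set \<Rightarrow> 'a \<Rightarrow> 'a \<Rightarrow> real" where
  "word_dist G S x y =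
    (if x \<in> carrier G \<and> y \<in> carrier G then real (word_length G S (inv\<^bsub>G\<^esub> x \<otimes>\<^bsub>G\<^esub> y)) else 0)"

context group
begin

lemma is_word_carrier: "S \<subseteq> carrier G \<Longrightarrow> is_word G S ws \<Longrightarrow> set ws \<subseteq> carrier G"
  unfolding is_word_def by auto

lemma word_value_closed: "set ws \<subseteq> carrier G \<Longrightarrow> word_value G ws \<in> carrier G"
  by (induction ws) (auto simp: word_value_def)

lemma word_value_append:
  assumes "set us \<subseteq> carrier G" "set vs \<subseteq> carrier G"
  shows "word_value G (us @ vs) = word_value G us \<otimes> word_value G vs"
  using assms(1)
proof (induction us)
  case Nil
  then show ?case
    using word_value_closed[OF assms(2)] by (simp add: word_value_def)
next
  case (Cons a us)
  have "word_value G us \<in> carrier G" "word_value G vs \<in> carrier G"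
    using Cons.prems assms(2) word_value_closed by auto
  then show ?case
    using Cons by (simp add: word_value_def m_assoc)
qed

lemma word_value_inv:
  assumes "set ws \<subseteq> carrier G"
  shows "word_value G (rev (map (m_inv G) ws)) = inv (word_value G ws)"
  using assms
proof (induction ws)
  case Nil
  then show ?case by (simp add: word_value_def)
next
  case (Cons a ws)
  have c: "a \<in> carrier G" "word_value G ws \<in> carrier G" "set (rev (map (m_inv G) ws)) \<subseteq> carrier G"
    using Cons.prems word_value_closed by auto
  have "word_value G (rev (map (m_inv G) (a # ws)))
      = word_value G (rev (map (m_inv G) ws)) \<otimes> word_value G [inv a]"
    using c by (simp add: word_value_append)
  also have "\<dots> = inv (word_value G ws) \<otimes> inv a"
    using Cons c by (simp add: word_value_def)
  also have "\<dots> = inv (word_value G (a # ws))"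
    using c by (simp add: word_value_def inv_mult_group)
  finally show ?case .
qed

lemma is_word_inv:
  assumes "S \<subseteq> carrier G" "is_word G S ws"
  shows "is_word G S (rev (map (m_inv G) ws))"
  using assms unfolding is_word_def by (force simp: subset_iff)

lemma word_exists:
  assumes "S \<subseteq> carrier G" "g \<in> generate G S"
  shows "\<exists>ws. is_word G S ws \<and> word_value G ws = g"
  using assms(2)
proof induction
  case one
  show ?case by (rule exI[of _ "[]"]) (simp add: is_word_def word_value_def)
next
  case (incl h)
  then show ?case using assms(1) 
    by (intro exI[of _ "[h]"]) (auto simp: is_word_def word_value_def)
next
  case (inv h)
  then show ?case using assms(1) 
    by (intro exI[of _ "[inv h]"]) (auto simp: is_word_def word_value_def)
next
  case (eng g h)
  then obtain us vs where "is_word G S us" "word_value G us = g" "is_word G S vs" "word_value G vs = h"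
    by blast
  then show ?case using assms(1)
    by (intro exI[of _ "us @ vs"]) (auto simp: word_value_append is_word_carrier, simp add: is_word_def)
qed

lemma word_length_le: "is_word G S ws \<Longrightarrow> word_length G S (word_value G ws) \<le> length ws"
  unfolding word_length_def by (rule Least_le) blast

lemma word_length_attained:
  assumes "S \<subseteq> carrier G" "g \<in> generate G S"
  obtains ws where "is_word G S ws" "word_value G ws = g" "length ws = word_length G S g"
proof -
  have "\<exists>n ws. is_word G S ws \<and> word_value G ws = g \<and> length ws = n"
    using word_exists[OF assms] by blast
  from LeastI_ex[OF this] show ?thesis
    unfolding word_length_def[symmetric] using that by blast
qed

lemma word_length_inv_le:
  assumes "S \<subseteq> carrier G" "g \<in> generate G S"
  shows "word_length G S (inv g) \<le> word_length G S g"
proof -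
  obtain ws where ws: "is_word G S ws" "word_value G ws = g" "length ws = word_length G S g"
    using word_length_attained[OF assms] .
  show ?thesis
    using word_length_le[OF is_word_inv[OF assms(1) ws(1)]] ws
      word_value_inv[OF is_word_carrier[OF assms(1) ws(1)]] by simp
qed

lemma word_length_mult_le:
  assumes "S \<subseteq> carrier G" "g \<in> generate G S" "h \<in> generate G S"
  shows "word_length G S (g \<otimes> h) \<le> word_length G S g + word_length G S h"
proof -
  obtain us where us: "is_word G S us" "word_value G us = g" "length us = word_length G S g"
    using word_length_attained[OF assms(1,2)] .
  obtain vs where vs: "is_word G S vs" "word_value G vs = h" "length vs = word_length G S h"
    using word_length_attained[OF assms(1,3)] .
  have "is_word G S (us @ vs)"
    using us(1) vs(1) by (simp add: is_word_def)
  from word_length_le[OF this] show ?thesis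
    using us vs word_value_append is_word_carrier[OF assms(1)] by simp
qed

lemma word_length_eq_0_iff:
  assumes "S \<subseteq> carrier G" "g \<in> generate G S"
  shows "word_length G S g = 0 \<longleftrightarrow> g = \<one>"
proof
  assume "word_length G S g = 0"
  then show "g = \<one>"
    using word_length_attained[OF assms] by (metis foldr.simps(1) id_apply length_0_conv word_value_def)
next
  assume "g = \<one>"
  then show "word_length G S g = 0"
    using word_length_le[of S "[]"] by (simp add: is_word_def word_value_def)
qed

lemma Metric_space_word_dist:
  assumes S: "S \<subseteq> carrier G" and gen: "generate G S = carrier G"
  shows "Metric_space (carrier G) (word_dist G S)"
proof
  show "0 \<le> word_dist G S x y" for x y
    by (simp add: word_dist_def)
  have le: "word_dist G S x y \<le> word_dist G S y x" for x y
  proof (cases "x \<in> carrier G \<and> y \<in> carrier G")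
    case True
    then have "inv x \<otimes> y = inv (inv y \<otimes> x)"
      by (simp add: inv_mult_group)
    then show ?thesis
      using True word_length_inv_le[OF S, of "inv y \<otimes> x"] gen by (simp add: word_dist_def)
  qed (auto simp: word_dist_def)
  show "word_dist G S x y = word_dist G S y x" for x y
    using le by (simp add: order_antisym)
  show "word_dist G S x y = 0 \<longleftrightarrow> x = y" if "x \<in> carrier G" "y \<in> carrier G" for x y
  proof -
    have "inv x \<otimes> y = \<one> \<longleftrightarrow> x = y"
      using that by (metis inv_closed inv_equality inv_inv l_inv)
    then show ?thesis
      using that gen by (simp add: word_dist_def word_length_eq_0_iff[OF S])
  qed
  show "word_dist G S x z \<le> word_dist G S x y + word_dist G S y z"
    if "x \<in> carrier G" "y \<in> carrier G" "z \<in> carrier G" for x y z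
  proof -
    have "inv x \<otimes> z = (inv x \<otimes> y) \<otimes> (inv y \<otimes> z)"
      using that by (metis inv_closed inv_solve_left m_assoc m_closed)
    then have "word_length G S (inv x \<otimes> z)
        \<le> word_length G S (inv x \<otimes> y) + word_length G S (inv y \<otimes> z)"
      using word_length_mult_le[OF S, of "inv x \<otimes> y" "inv y \<otimes> z"] that gen by simp
    then show ?thesis
      using that by (simp add: word_dist_def)
  qed
qed

end


section \<open>Nilpotent groups and Hirsch length\<close>

primrec lower_central_series :: "('a, 'b) monoid_scheme \<Rightarrow> nat \<Rightarrow> 'a set" where
  "lower_central_series G 0 = carrier G"
| "lower_central_series G (Suc k) = generate G
     {x \<otimes>\<^bsub>G\<^esub> y \<otimes>\<^bsub>G\<^esub> inv\<^bsub>G\<^esub> x \<otimes>\<^bsub>G\<^esub> inv\<^bsub>G\<^esub> y | x y. x \<in> lower_central_series G k \<and> y \<in> carrier G}"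

definition nilpotent_group :: "('a, 'b) monoid_scheme \<Rightarrow> bool" where
  "nilpotent_group G \<longleftrightarrow> group G \<and> (\<exists>k. lower_central_series G k = {\<one>\<^bsub>G\<^esub>})"

definition series_factor :: "('a, 'b) monoid_scheme \<Rightarrow> (nat \<Rightarrow> 'a set) \<Rightarrow> nat \<Rightarrow> 'a set monoid" where
  "series_factor G H i = (G\<lparr>carrier := H (Suc i)\<rparr>) Mod H i"

text \<open>The inclusions need not be strict; trivial factors do not affect the number of infinite
  cyclic ones.\<close>

definition polycyclic_series :: "('a, 'b) monoid_scheme \<Rightarrow> nat \<Rightarrow> (nat \<Rightarrow> 'a set) \<Rightarrow> bool" where
  "polycyclic_series G n H \<longleftrightarrow>
     H 0 = {\<one>\<^bsub>G\<^esub>} \<and> H n = carrier G \<and> (\<forall>i\<le>n. subgroup (H i) G) \<and>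
     (\<forall>i<n. H i \<lhd> G\<lparr>carrier := H (Suc i)\<rparr> \<and> cyclic_group (series_factor G H i))"

definition infinite_cyclic_factors :: "('a, 'b) monoid_scheme \<Rightarrow> nat \<Rightarrow> (nat \<Rightarrow> 'a set) \<Rightarrow> nat" where
  "infinite_cyclic_factors G n H = card {i. i < n \<and> series_factor G H i \<cong> integer_group}"

text \<open>The number of infinite cyclic factors is the same for all polycyclic series of a group, so
  the choice made here is immaterial. For a group that is not polycyclic the value is
  unspecified.\<close>

definition hirsch_length :: "('a, 'b) monoid_scheme \<Rightarrow> nat" where
  "hirsch_length G =
     (SOME h. \<exists>n H. polycyclic_series G n H \<and> h = infinite_cyclic_factors G n H)"

end

theory Submission
  imports Defs "HOL-Algebra.Multiplicative_Group"
begin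

text \<open>
  A finitely generated nilpotent group is polycyclic because every term of its lower central series
  is finitely generated modulo the next one. It therefore suffices to bound the asymptotic dimension
  by the number of infinite cyclic factors of an arbitrary polycyclic series, by induction along the
  series. A finite factor moves every element a bounded distance only. For an extension of \<open>K\<close> by
  \<open>\<int>\<close>, with projection \<open>f\<close> to \<open>\<int>\<close>, cut the group into the preimages of consecutive intervals of equal
  length; these blocks are translates of one bounded neighbourhood of \<open>K\<close>, so their asymptotic
  dimension is at most \<open>k = asdim K\<close> uniformly. With \<open>k + 2\<close> colours, let the \<open>l\<close>-th block omit the
  colour \<open>l mod (k + 2)\<close>. Each colour then has regular gaps, and between two gaps the \<open>k + 1\<close> blocks
  can be covered at rapidly increasing scales, which keeps the chain components of their union
  bounded.
\<close>

section \<open>Asymptotic dimension via chains\<close>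

text \<open>The scale at stage \<open>j + 1\<close> is chosen as the lemma \<open>bounded_chains_union\<close> below needs it, given the bound
  reached at stage \<open>j\<close>; \<open>\<rho> s\<close> is the bound on the pieces available at scale \<open>s\<close>.\<close>

primrec tower :: "(real \<Rightarrow> real) \<Rightarrow> real \<Rightarrow> nat \<Rightarrow> real" where
  "tower \<rho> D 0 = \<rho> D"
| "tower \<rho> D (Suc j) = 2 * (\<rho> (tower \<rho> D j + 2 * D) + D + tower \<rho> D j)"

definition tower_scale :: "(real \<Rightarrow> real) \<Rightarrow> real \<Rightarrow> nat \<Rightarrow> real" where
  "tower_scale \<rho> D j = (case j of 0 \<Rightarrow> D | Suc i \<Rightarrow> tower \<rho> D i + 2 * D)"

context Metric_space
begin

section \<open>Chains with bounded steps and the size of chain components\<close>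

definition chain_step :: "real \<Rightarrow> 'a set \<Rightarrow> ('a \<times> 'a) set" where
  "chain_step D A = {(x, y). x \<in> A \<and> y \<in> A \<and> d x y \<le> D}"

text \<open>The components are described through reachability, so that unions, neighbourhoods and
  images can be treated by induction along a chain.\<close>

definition bounded_chains :: "real \<Rightarrow> real \<Rightarrow> 'a set \<Rightarrow> bool" where
  "bounded_chains D R A \<longleftrightarrow> A \<subseteq> M \<and> (\<forall>x\<in>A. \<forall>y. (x, y) \<in> (chain_step D A)\<^sup>* \<longrightarrow> d x y \<le> R)"

lemma chain_step_rtrancl_mem:
  "(x, y) \<in> (chain_step D A)\<^sup>* \<Longrightarrow> x \<in> A \<Longrightarrow> y \<in> A"
  by (induction rule: rtrancl_induct) (auto simp: chain_step_def)

lemma chain_step_rtrancl_sym: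
  assumes "(x, y) \<in> (chain_step D A)\<^sup>*"
  shows "(y, x) \<in> (chain_step D A)\<^sup>*"
proof -
  have "sym (chain_step D A)"
    unfolding sym_def chain_step_def using commute by simp
  then show ?thesis
    using assms by (meson sym_rtrancl symD)
qed

lemma bounded_chainsD:
  "bounded_chains D R A \<Longrightarrow> x \<in> A \<Longrightarrow> (x, y) \<in> (chain_step D A)\<^sup>* \<Longrightarrow> d x y \<le> R"
  by (simp add: bounded_chains_def)

lemma bounded_chains_empty [simp]: "bounded_chains D R {}"
  by (simp add: bounded_chains_def)

lemma bounded_chains_mono:
  assumes "bounded_chains D' R' B" "A \<subseteq> B" "D \<le> D'" "R' \<le> R"
  shows "bounded_chains D R A"
proof -
  have "chain_step D A \<subseteq> chain_step D' B"
    using assms by (auto simp: chain_step_def)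
  then have "(chain_step D A)\<^sup>* \<subseteq> (chain_step D' B)\<^sup>*"
    by (rule rtrancl_mono)
  then show ?thesis
    using assms unfolding bounded_chains_def by (meson order_trans subsetD)
qed

text \<open>Between two visits to \<open>A'\<close> a chain runs inside \<open>A\<close> and drifts
  by at most \<open>B\<close>, plus one \<open>D\<close>-step on leaving \<open>A'\<close> and one
  on returning. Contracting these excursions leaves a \<open>(B + 2 * D)\<close>-chain in
  \<open>A'\<close>. The factor 2 comes from measuring both endpoints from a common point of
  \<open>A'\<close>.\<close>

lemma bounded_chains_union:
  assumes A: "bounded_chains D B A" and A': "bounded_chains (B + 2 * D) R A'"
    and nonneg: "0 \<le> D" "0 \<le> B" "0 \<le> R"
  shows "bounded_chains D (2 * (R + D + B)) (A \<union> A')"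
proof -
  have sub: "A \<subseteq> M" "A' \<subseteq> M"
    using A A' by (auto simp: bounded_chains_def)
  \<comment> \<open>\<open>a'\<close> is the last point of \<open>A'\<close> visited, and
    \<open>z0\<close> is where the excursion through \<open>A\<close> that ends at \<open>z\<close>
    begins.\<close>
  have follow: "\<exists>a'. (a, a') \<in> (chain_step (B + 2 * D) A')\<^sup>* \<and>
      (z = a' \<or> (\<exists>z0\<in>A. d a' z0 \<le> D \<and> (z0, z) \<in> (chain_step D A)\<^sup>*))"
    if "(a, z) \<in> (chain_step D (A \<union> A'))\<^sup>*" "a \<in> A'" for a z
    using that
  proof (induction rule: rtrancl_induct)
    case base
    then show ?case by blast
  next
    case (step y z)
    have yz: "y \<in> A \<union> A'" "z \<in> A \<union> A'" "d y z \<le> D"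
      using step.hyps by (auto simp: chain_step_def)
    obtain a' where a': "(a, a') \<in> (chain_step (B + 2 * D) A')\<^sup>*"
      and y: "y = a' \<or> (\<exists>z0\<in>A. d a' z0 \<le> D \<and> (z0, y) \<in> (chain_step D A)\<^sup>*)"
      using step by blast
    have a'A: "a' \<in> A'"
      using chain_step_rtrancl_mem[OF a' step.prems] .
    show ?case
    proof (cases "z \<in> A'")
      case True
      have "d a' z \<le> B + 2 * D"
        using y
      proof
        assume "y = a'"
        then show ?thesis using yz nonneg by simp
      next
        assume "\<exists>z0\<in>A. d a' z0 \<le> D \<and> (z0, y) \<in> (chain_step D A)\<^sup>*"
        then obtain z0 where z0: "z0 \<in> A" "d a' z0 \<le> D" "(z0, y) \<in> (chain_step D A)\<^sup>*"
          by blast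
        have "d z0 y \<le> B" "y \<in> A"
          by (rule bounded_chainsD[OF A z0(1,3)], rule chain_step_rtrancl_mem[OF z0(3,1)])
        moreover have "d a' z \<le> d a' z0 + d z0 y + d y z"
          using triangle[of a' z0 z] triangle[of z0 y z] subsetD[OF sub(2) a'A] subsetD[OF sub(1) z0(1)]
            subsetD[OF sub(1) \<open>y \<in> A\<close>] subsetD[OF sub(2) True] by simp
        ultimately show ?thesis using z0 yz by simp
      qed
      then have "(a', z) \<in> chain_step (B + 2 * D) A'"
        using True a'A by (simp add: chain_step_def)
      then show ?thesis using a' by (blast intro: rtrancl_into_rtrancl)
    next
      case False
      then have zA: "z \<in> A" using yz by blast
      show ?thesis
        using y
      proof
        assume "y = a'"
        then show ?thesis using a' zA yz by blast
      next
        assume "\<exists>z0\<in>A. d a' z0 \<le> D \<and> (z0, y) \<in> (chain_step D A)\<^sup>*"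
        then obtain z0 where z0: "z0 \<in> A" "d a' z0 \<le> D" "(z0, y) \<in> (chain_step D A)\<^sup>*"
          by blast
        have "y \<in> A" by (rule chain_step_rtrancl_mem[OF z0(3,1)])
        then have "(y, z) \<in> chain_step D A"
          using zA yz(3) by (simp add: chain_step_def)
        with z0(3) have "(z0, z) \<in> (chain_step D A)\<^sup>*" by (rule rtrancl_into_rtrancl)
        then show ?thesis using a' z0 by blast
      qed
    qed
  qed
  \<comment> \<open>The last visit to \<open>A'\<close> is within \<open>R\<close> of
    \<open>a\<close>; the step into \<open>A\<close> adds \<open>D\<close> and the excursion adds
    \<open>B\<close>.\<close>
  have far: "d a z \<le> R + D + B" if az: "(a, z) \<in> (chain_step D (A \<union> A'))\<^sup>*" "a \<in> A'" for a z
  proof -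
    obtain a' where a': "(a, a') \<in> (chain_step (B + 2 * D) A')\<^sup>*"
      and z: "z = a' \<or> (\<exists>z0\<in>A. d a' z0 \<le> D \<and> (z0, z) \<in> (chain_step D A)\<^sup>*)"
      using follow[OF az] by blast
    have aa': "d a a' \<le> R" "a' \<in> A'"
      by (rule bounded_chainsD[OF A' az(2) a'], rule chain_step_rtrancl_mem[OF a' az(2)])
    from z show ?thesis
    proof
      assume "z = a'"
      then show ?thesis using aa' nonneg by simp
    next
      assume "\<exists>z0\<in>A. d a' z0 \<le> D \<and> (z0, z) \<in> (chain_step D A)\<^sup>*"
      then obtain z0 where z0: "z0 \<in> A" "d a' z0 \<le> D" "(z0, z) \<in> (chain_step D A)\<^sup>*"
        by blast
      have "d z0 z \<le> B" "z \<in> A"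
        by (rule bounded_chainsD[OF A z0(1,3)], rule chain_step_rtrancl_mem[OF z0(3,1)])
      moreover have "d a z \<le> d a a' + d a' z0 + d z0 z"
        using triangle[of a a' z] triangle[of a' z0 z] subsetD[OF sub(2) az(2)] subsetD[OF sub(2) aa'(2)]
          subsetD[OF sub(1) z0(1)] subsetD[OF sub(1) \<open>z \<in> A\<close>] by simp
      ultimately show ?thesis using z0 aa' by simp
    qed
  qed
  have "d x y \<le> 2 * (R + D + B)"
    if x: "x \<in> A \<union> A'" and xy: "(x, y) \<in> (chain_step D (A \<union> A'))\<^sup>*" for x y
  proof (cases "\<exists>a\<in>A'. (x, a) \<in> (chain_step D (A \<union> A'))\<^sup>*")
    case True
    then obtain a where a: "a \<in> A'" "(x, a) \<in> (chain_step D (A \<union> A'))\<^sup>*" by blast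
    then have ax: "(a, x) \<in> (chain_step D (A \<union> A'))\<^sup>*"
      using chain_step_rtrancl_sym by blast
    then have ay: "(a, y) \<in> (chain_step D (A \<union> A'))\<^sup>*"
      using xy by (rule rtrancl_trans)
    have "y \<in> A \<union> A'" by (rule chain_step_rtrancl_mem[OF xy x])
    then have "d x y \<le> d x a + d a y"
      using triangle[of x a y] x a sub by blast
    then show ?thesis using far[OF ax a(1)] far[OF ay a(1)] by (simp add: commute)
  next
    case False
    \<comment> \<open>Here no point reachable from \<open>x\<close> lies in \<open>A'\<close>, so
      each step of the chain is a step inside \<open>A\<close>.\<close>
    from xy have "(x, y) \<in> (chain_step D A)\<^sup>*"
    proof (induction rule: rtrancl_induct)
      case (step y z)
      then have "y \<notin> A'" "z \<notin> A'" using False rtrancl.rtrancl_into_rtrancl by metis+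
      then have "(y, z) \<in> chain_step D A" using step.hyps by (auto simp: chain_step_def)
      then show ?case using step.IH by (rule rtrancl_into_rtrancl[rotated])
    qed simp
    moreover have "x \<in> A" using x False by blast
    ultimately have "d x y \<le> B" using bounded_chainsD[OF A] by blast
    then show ?thesis using nonneg by (simp add: distrib_left)
  qed
  then show ?thesis using sub by (auto simp: bounded_chains_def)
qed

text \<open>Replacing each point of a chain by a point of \<open>A\<close> within \<open>C\<close>
  of it lengthens the steps to at most \<open>D + 2 * C\<close>. The two endpoints account for the
  extra \<open>2 * C\<close> in the bound.\<close>

lemma bounded_chains_thicken:
  assumes A: "bounded_chains (D + 2 * C) R A"
  shows "bounded_chains D (R + 2 * C) {x \<in> M. \<exists>a\<in>A. d a x \<le> C}" (is "bounded_chains _ _ ?N")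
proof -
  have sub: "A \<subseteq> M" using A by (simp add: bounded_chains_def)
  have follow: "\<exists>b\<in>A. d b y \<le> C \<and> (a, b) \<in> (chain_step (D + 2 * C) A)\<^sup>*"
    if "(x, y) \<in> (chain_step D ?N)\<^sup>*" "a \<in> A" "d a x \<le> C" for a x y
    using that
  proof (induction rule: rtrancl_induct)
    case (step y z)
    then obtain b where b: "b \<in> A" "d b y \<le> C" "(a, b) \<in> (chain_step (D + 2 * C) A)\<^sup>*" by blast
    obtain c where c: "c \<in> A" "d c z \<le> C" and yz: "y \<in> M" "z \<in> M" "d y z \<le> D"
      using step.hyps by (auto simp: chain_step_def)
    have "d b c \<le> d b y + d y z + d z c"
      using triangle[of b y c] triangle[of y z c] subsetD[OF sub b(1)] subsetD[OF sub c(1)] yz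
      by (simp add: commute)
    then have "(b, c) \<in> chain_step (D + 2 * C) A"
      using b c yz by (simp add: chain_step_def commute)
    then show ?case using b c by (blast intro: rtrancl_into_rtrancl)
  qed blast
  have "d x y \<le> R + 2 * C" if xy: "x \<in> ?N" "(x, y) \<in> (chain_step D ?N)\<^sup>*" for x y
  proof -
    obtain a where a: "a \<in> A" "d a x \<le> C" using xy by blast
    obtain b where b: "b \<in> A" "d b y \<le> C" "(a, b) \<in> (chain_step (D + 2 * C) A)\<^sup>*"
      using follow[OF xy(2) a] by blast
    have "d a b \<le> R" by (rule bounded_chainsD[OF A a(1) b(3)])
    moreover have "y \<in> M" using chain_step_rtrancl_mem[OF xy(2,1)] by blast
    then have "d x y \<le> d x a + d a b + d b y"
      using triangle[of x a y] triangle[of a b y] subsetD[OF sub a(1)] subsetD[OF sub b(1)] xy(1) by simp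
    ultimately show ?thesis using a b by (simp add: commute)
  qed
  then show ?thesis by (auto simp: bounded_chains_def)
qed

text \<open>A chain in the image lifts point by point to a chain in \<open>A\<close>, because the
  steps have the same length on both sides.\<close>

lemma bounded_chains_image:
  assumes A: "bounded_chains D R A" and "\<phi> ` A \<subseteq> M"
    and isometric: "\<And>x y. x \<in> A \<Longrightarrow> y \<in> A \<Longrightarrow> d (\<phi> x) (\<phi> y) = d x y"
  shows "bounded_chains D R (\<phi> ` A)"
proof -
  have lift: "\<exists>y. z = \<phi> y \<and> (x, y) \<in> (chain_step D A)\<^sup>*"
    if "(\<phi> x, z) \<in> (chain_step D (\<phi> ` A))\<^sup>*" "x \<in> A" for x z
    using that
  proof (induction rule: rtrancl_induct)
    case (step u v)
    then obtain y where y: "u = \<phi> y" "(x, y) \<in> (chain_step D A)\<^sup>*" by blast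
    have "y \<in> A" by (rule chain_step_rtrancl_mem[OF y(2) step.prems])
    moreover obtain z where z: "z \<in> A" "v = \<phi> z"
      using step.hyps by (auto simp: chain_step_def)
    ultimately have "(y, z) \<in> chain_step D A"
      using step.hyps y isometric by (simp add: chain_step_def)
    with y(2) have "(x, z) \<in> (chain_step D A)\<^sup>*" by (rule rtrancl_into_rtrancl)
    then show ?case using z by blast
  qed blast
  have "d (\<phi> x) z \<le> R" if x: "x \<in> A" and z: "(\<phi> x, z) \<in> (chain_step D (\<phi> ` A))\<^sup>*" for x z
  proof -
    obtain y where y: "z = \<phi> y" "(x, y) \<in> (chain_step D A)\<^sup>*" using lift[OF z x] by blast
    have "y \<in> A" by (rule chain_step_rtrancl_mem[OF y(2) x])
    then show ?thesis using bounded_chainsD[OF A x y(2)] isometric x y(1) by simp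
  qed
  then show ?thesis using assms(2) by (auto simp: bounded_chains_def)
qed

text \<open>A label that no \<open>D\<close>-step changes is constant along every chain, so each
  chain stays in one fibre of \<open>r\<close>.\<close>

lemma bounded_chains_invariant:
  assumes "A \<subseteq> M" and inv: "\<And>u v. u \<in> A \<Longrightarrow> v \<in> A \<Longrightarrow> d u v \<le> D \<Longrightarrow> r u = r v"
    and parts: "\<And>q. bounded_chains D R {u \<in> A. r u = q}"
  shows "bounded_chains D R A"
proof -
  have "(x, y) \<in> (chain_step D {u \<in> A. r u = r x})\<^sup>* \<and> r y = r x"
    if "(x, y) \<in> (chain_step D A)\<^sup>*" for x y
    using that
  proof (induction rule: rtrancl_induct)
    case (step y z)
    then have "y \<in> A" "z \<in> A" "d y z \<le> D" by (auto simp: chain_step_def)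
    then have "r z = r x" using inv step.IH by metis
    then have "(y, z) \<in> chain_step D {u \<in> A. r u = r x}"
      using \<open>y \<in> A\<close> \<open>z \<in> A\<close> \<open>d y z \<le> D\<close> step.IH by (simp add: chain_step_def)
    then show ?case using step.IH \<open>r z = r x\<close> by (blast intro: rtrancl_into_rtrancl)
  qed simp
  then have "d x y \<le> R" if "x \<in> A" "(x, y) \<in> (chain_step D A)\<^sup>*" for x y
    using that bounded_chainsD[OF parts, of x "r x" y] by blast
  then show ?thesis using assms(1) by (simp add: bounded_chains_def)
qed

section \<open>Asymptotic dimension, uniformly over a family of sets\<close>

text \<open>Asymptotic dimension in terms of chains: a set that satisfies \<^const>\<open>bounded_chains\<close> at scale \<open>D\<close>
  falls apart into uniformly bounded \<open>D\<close>-disjoint pieces, its \<open>D\<close>-chain components. The bound \<open>R\<close>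
  is common to all members of the family \<open>\<X>\<close>.\<close>

definition uniform_asdim_le :: "'a set set \<Rightarrow> nat \<Rightarrow> bool" where
  "uniform_asdim_le \<X> n \<longleftrightarrow>
    (\<forall>D. \<exists>R. \<forall>X\<in>\<X>. \<exists>A. X = (\<Union>i\<le>n. A i) \<and> (\<forall>i\<le>n. bounded_chains D R (A i)))"

lemma uniform_asdim_le_singleton:
  "uniform_asdim_le {X} n \<longleftrightarrow>
    (\<forall>D. \<exists>R A. X = (\<Union>i\<le>n. A i) \<and> (\<forall>i\<le>n. bounded_chains D R (A i)))"
  by (simp add: uniform_asdim_le_def)

lemma uniform_asdim_le_subset:
  assumes "uniform_asdim_le \<Y> n" "\<X> \<subseteq> \<Y>"
  shows "uniform_asdim_le \<X> n"
  unfolding uniform_asdim_le_def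
proof
  fix D
  obtain R where "\<forall>X\<in>\<Y>. \<exists>A. X = (\<Union>i\<le>n. A i) \<and> (\<forall>i\<le>n. bounded_chains D R (A i))"
    using assms(1)[unfolded uniform_asdim_le_def, THEN spec, of D] by (elim exE) (rule that)
  then show "\<exists>R. \<forall>X\<in>\<X>. \<exists>A. X = (\<Union>i\<le>n. A i) \<and> (\<forall>i\<le>n. bounded_chains D R (A i))"
    using assms(2) by (intro exI[of _ R] ballI) (erule bspec, erule subsetD)
qed

lemma asdim_leI:
  assumes "uniform_asdim_le {M} n"
  shows "asdim_le n"
  unfolding asdim_le_def
proof (intro allI impI)
  fix D :: real
  \<comment> \<open>The reserve of 1 puts distinct components at distance at least
    \<open>D + 1\<close>, so that the infimum is strictly larger than \<open>D\<close>.\<close>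
  obtain R A where M: "M = (\<Union>i\<le>n. A i)" and A: "\<forall>i\<le>n. bounded_chains (D + 1) R (A i)"
    using assms[unfolded uniform_asdim_le_singleton, THEN spec, of "D + 1"] by (elim exE conjE) (rule that)
  note A = A[rule_format]
  define E where "E i = (chain_step (D + 1) (A i))\<^sup>*" for i
  have E_sym: "(x, y) \<in> E i \<Longrightarrow> (y, x) \<in> E i"
    and E_trans: "(x, y) \<in> E i \<Longrightarrow> (y, z) \<in> E i \<Longrightarrow> (x, z) \<in> E i"
    and E_mem: "(x, y) \<in> E i \<Longrightarrow> x \<in> A i \<Longrightarrow> y \<in> A i" for x y z i
    unfolding E_def by (fact chain_step_rtrancl_sym rtrancl_trans chain_step_rtrancl_mem)+
  define \<U> where "\<U> i = (\<lambda>x. E i `` {x}) ` A i" for i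
  have "uniformly_bounded (\<U> i)" if i: "i \<le> n" for i
  proof -
    have "d y z \<le> R" "y \<in> M" if "x \<in> A i" "(x, y) \<in> E i" "(x, z) \<in> E i" for x y z
    proof -
      have "(y, z) \<in> E i"
        using that E_sym E_trans by metis
      moreover have y: "y \<in> A i" using that E_mem by metis
      ultimately show "d y z \<le> R"
        using bounded_chainsD[OF A[OF i]] by (simp add: E_def)
      show "y \<in> M" using y A[OF i] by (auto simp: bounded_chains_def)
    qed
    then show ?thesis unfolding uniformly_bounded_def \<U>_def by blast
  qed
  moreover have "disjoint_family_at D (\<U> i)" if "i \<le> n" for i
    unfolding disjoint_family_at_def
  proof (intro ballI impI)
    fix P Q assume "P \<in> \<U> i" "Q \<in> \<U> i" "P \<noteq> Q"
    then obtain x y where xy: "x \<in> A i" "P = E i `` {x}" "y \<in> A i" "Q = E i `` {y}"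
      unfolding \<U>_def by blast
    have "D + 1 \<le> d p q" if "p \<in> P" "q \<in> Q" for p q
    proof (rule ccontr)
      assume "\<not> ?thesis"
      moreover have pq: "(x, p) \<in> E i" "(y, q) \<in> E i" "p \<in> A i" "q \<in> A i"
        using that xy E_mem by auto
      ultimately have "(p, q) \<in> E i" unfolding E_def chain_step_def by auto
      then have "(x, y) \<in> E i" "(y, x) \<in> E i"
        using pq E_sym E_trans by metis+
      then have "P = Q" using xy E_trans by blast
      then show False using \<open>P \<noteq> Q\<close> by simp
    qed
    then have "ereal (D + 1) \<le> set_distance P Q"
      unfolding set_distance_def by (intro INF_greatest) simp
    then show "ereal D < set_distance P Q"
      by (rule less_le_trans[rotated]) simp
  qed
  moreover have "(\<Union>i\<le>n. \<Union>(\<U> i)) = M"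
  proof -
    have "\<Union>(\<U> i) = A i" for i
      using E_mem by (auto simp: \<U>_def E_def)
    then show ?thesis using M by simp
  qed
  ultimately show "\<exists>\<U>. (\<forall>i\<le>n. uniformly_bounded (\<U> i) \<and> disjoint_family_at D (\<U> i)) \<and> (\<Union>i\<le>n. \<Union>(\<U> i)) = M"
    by (intro exI[of _ \<U>] conjI allI impI)
qed

text \<open>The pieces of \<open>X\<close> are thickened by \<open>C\<close> and cut back to
  \<open>Y\<close>; taking them at scale \<open>D + 2 * C\<close> pays for the thickening.\<close>

lemma uniform_asdim_le_thicken:
  assumes "uniform_asdim_le {X} n" and "Y \<subseteq> {y \<in> M. \<exists>x\<in>X. d x y \<le> C}"
  shows "uniform_asdim_le {Y} n"
  unfolding uniform_asdim_le_singleton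
proof (intro allI)
  fix D :: real
  obtain R A where X: "X = (\<Union>i\<le>n. A i)"
    and A: "\<forall>i\<le>n. bounded_chains (D + 2 * C) R (A i)"
    using assms(1)[unfolded uniform_asdim_le_singleton, THEN spec, of "D + 2 * C"]
    by (elim exE conjE) (rule that)
  note A = A[rule_format]
  define B where "B i = Y \<inter> {y \<in> M. \<exists>x\<in>A i. d x y \<le> C}" for i
  have "Y = (\<Union>i\<le>n. B i)"
    using assms(2) X by (auto simp: B_def)
  moreover have "bounded_chains D (R + 2 * C) (B i)" if "i \<le> n" for i
    by (rule bounded_chains_mono[OF bounded_chains_thicken[OF A[OF that]]]) (auto simp: B_def)
  ultimately show "\<exists>R A. Y = (\<Union>i\<le>n. A i) \<and> (\<forall>i\<le>n. bounded_chains D R (A i))"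
    by (intro exI conjI allI impI)
qed

text \<open>Iterates \<open>bounded_chains_union\<close>, one set at a time. Since
  \<open>tower \<rho> D j\<close> bounds the chains in the union of \<open>Z 0\<close> to
  \<open>Z j\<close>, the next set has to tolerate steps of that bound plus
  \<open>2 * D\<close>.\<close>

lemma bounded_chains_tower:
  assumes "0 \<le> D" "\<And>s. 0 \<le> \<rho> s"
    and "\<And>j. j \<le> m \<Longrightarrow> bounded_chains (tower_scale \<rho> D j) (\<rho> (tower_scale \<rho> D j)) (Z j)"
  shows "bounded_chains D (tower \<rho> D m) (\<Union>j\<le>m. Z j)"
  using assms(3)
proof (induction m)
  case 0
  from 0[of 0] show ?case by (simp add: tower_scale_def)
next
  case (Suc m)
  have "0 \<le> tower \<rho> D m"
    using assms by (induction m) auto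
  then have "bounded_chains D (tower \<rho> D (Suc m)) ((\<Union>j\<le>m. Z j) \<union> Z (Suc m))"
    using bounded_chains_union[OF Suc.IH[OF Suc.prems], of "\<rho> (tower \<rho> D m + 2 * D)" "Z (Suc m)"]
      Suc.prems[of "Suc m"] assms(1,2)
    by (simp add: tower_scale_def)
  then show ?case by (simp add: atMost_Suc Un_commute)
qed

text \<open>Among \<open>n + 2\<close> colours, block \<open>l\<close> omits the colour \<open>l mod (n + 2)\<close>, and its scale depends on
  \<open>l mod (n + 2)\<close>. A block is longer than any \<open>D\<close>-step, so a \<open>D\<close>-chain of colour \<open>c\<close> cannot
  cross a block that omits \<open>c\<close>. It therefore stays within \<open>n + 1\<close> blocks of distinct scales.\<close>

lemma uniform_asdim_le_fibration:
  fixes f :: "'a \<Rightarrow> int"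
  assumes "X \<subseteq> M"
    and f: "\<And>D. \<exists>L. \<forall>x\<in>X. \<forall>y\<in>X. d x y \<le> D \<longrightarrow> \<bar>f x - f y\<bar> \<le> L"
    and blocks: "\<And>L. L > 0 \<Longrightarrow> uniform_asdim_le (range (\<lambda>l. {x \<in> X. f x div L = l})) n"
  shows "uniform_asdim_le {X} (Suc n)"
proof -
  have nonneg: "\<exists>R A. X = (\<Union>i\<le>Suc n. A i) \<and> (\<forall>i\<le>Suc n. bounded_chains D R (A i))"
    if D: "0 \<le> D" for D
  proof -
    obtain L0 where L0: "\<And>x y. x \<in> X \<Longrightarrow> y \<in> X \<Longrightarrow> d x y \<le> D \<Longrightarrow> \<bar>f x - f y\<bar> \<le> L0"
      using f by blast
    \<comment> \<open>Longer than any change of \<open>f\<close> along a \<open>D\<close>-step, so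
      such a step joins equal or adjacent blocks; the maximum makes it positive.\<close>
    define L where "L = max L0 0 + 1"
    have L: "L > 0" "L > L0" by (auto simp: L_def)
    define B where "B l = {x \<in> X. f x div L = l}" for l
    \<comment> \<open>At each scale one bound serves all blocks; it is made nonnegative because the
      tower is built from nonnegative bounds.\<close>
    have "\<exists>R\<ge>0. \<forall>l. \<exists>A. B l = (\<Union>i\<le>n. A i) \<and> (\<forall>i\<le>n. bounded_chains s R (A i))" for s
    proof -
      obtain R where R: "\<And>l. \<exists>A. B l = (\<Union>i\<le>n. A i) \<and> (\<forall>i\<le>n. bounded_chains s R (A i))"
        using blocks[OF L(1), unfolded uniform_asdim_le_def, THEN spec, of s] unfolding B_def by auto
      have "\<exists>A. B l = (\<Union>i\<le>n. A i) \<and> (\<forall>i\<le>n. bounded_chains s (max R 0) (A i))" for l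
        using R[of l] bounded_chains_mono by (meson max.cobounded1 order_refl)
      then show ?thesis by (intro exI[of _ "max R 0"]) auto
    qed
    then obtain \<rho> where \<rho>: "\<And>s. 0 \<le> \<rho> s"
      and cover: "\<And>s l. \<exists>A. B l = (\<Union>i\<le>n. A i) \<and> (\<forall>i\<le>n. bounded_chains s (\<rho> s) (A i))"
      by metis
    define N where "N = int (n + 2)"
    have N: "N > 0" by (simp add: N_def)
    define \<tau> where "\<tau> l = nat (l mod N)" for l
    have \<tau>: "int (\<tau> l) = l mod N" "\<tau> l \<le> Suc n" for l
    proof -
      show "int (\<tau> l) = l mod N" using N by (simp add: \<tau>_def)
      moreover have "l mod N < N" by (rule pos_mod_bound[OF N])
      ultimately show "\<tau> l \<le> Suc n" unfolding N_def by linarith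
    qed
    define s where "s = tower_scale \<rho> D"
    \<comment> \<open>The \<open>n + 1\<close> pieces of block \<open>l\<close> are distributed to
      the colours other than \<open>\<tau> l\<close>; \<open>\<kappa>\<close> closes the gap in the
      numbering.\<close>
    have "\<exists>C. B l = (\<Union>c\<le>Suc n. C c) \<and> C (\<tau> l) = {} \<and>
        (\<forall>c\<le>Suc n. bounded_chains (s (\<tau> l)) (\<rho> (s (\<tau> l))) (C c))" for l
    proof -
      obtain A where A: "B l = (\<Union>i\<le>n. A i)"
        "\<And>i. i \<le> n \<Longrightarrow> bounded_chains (s (\<tau> l)) (\<rho> (s (\<tau> l))) (A i)"
        using cover by metis
      define \<kappa> where "\<kappa> c = (if c < \<tau> l then c else c - 1)" for c
      define C where "C c = (if c = \<tau> l then {} else A (\<kappa> c))" for c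
      have AC: "A i \<subseteq> (\<Union>c\<le>Suc n. C c)" if "i \<le> n" for i
      proof (cases "i < \<tau> l")
        case True
        then have "A i = C i" by (simp add: C_def \<kappa>_def)
        then show ?thesis using that by force
      next
        case False
        then have "A i = C (Suc i)" by (simp add: C_def \<kappa>_def)
        then show ?thesis using that by force
      qed
      have colour: "\<kappa> c \<le> n" if "c \<le> Suc n" for c
        using that \<tau>(2)[of l] by (auto simp: \<kappa>_def)
      then have CA: "C c \<subseteq> (\<Union>i\<le>n. A i)" if "c \<le> Suc n" for c
        using that by (auto simp: C_def)
      have "B l = (\<Union>c\<le>Suc n. C c)"
        unfolding A(1) by (intro equalityI UN_least) (simp_all only: atMost_iff AC CA)
      moreover have "bounded_chains (s (\<tau> l)) (\<rho> (s (\<tau> l))) (C c)" if "c \<le> Suc n" for c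
        using A(2)[OF colour[OF that]] by (simp add: C_def)
      moreover have "C (\<tau> l) = {}" by (simp add: C_def)
      ultimately show ?thesis by (intro exI[of _ C] conjI allI impI)
    qed
    then obtain C where C: "\<And>l. B l = (\<Union>c\<le>Suc n. C l c)" "\<And>l. C l (\<tau> l) = {}"
      "\<And>l c. c \<le> Suc n \<Longrightarrow> bounded_chains (s (\<tau> l)) (\<rho> (s (\<tau> l))) (C l c)"
      by metis
    define K where "K c = (\<Union>l. C l c)" for c
    have X: "X = (\<Union>c\<le>Suc n. K c)"
    proof -
      have "X = (\<Union>l. B l)" by (auto simp: B_def)
      then show ?thesis unfolding K_def C(1) by blast
    qed
    have "bounded_chains D (tower \<rho> D (Suc n)) (K c)" if c: "c \<le> Suc n" for c
    \<comment> \<open>The label counts periods of \<open>N\<close> blocks. The shift by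
      \<open>c\<close> lets each period start at a block that omits colour \<open>c\<close>.\<close>
    proof (rule bounded_chains_invariant[where r = "\<lambda>x. (f x div L - int c) div N"])
      show "K c \<subseteq> M" using X assms(1) c by blast
      have K: "u \<in> X \<and> u \<in> C (f u div L) c \<and> \<not> (f u div L) mod N = int c" if u: "u \<in> K c" for u
      proof -
        obtain l where l: "u \<in> C l c" using u by (auto simp: K_def)
        then have "u \<in> B l" using C(1) c by blast
        then have "u \<in> X" "f u div L = l" by (auto simp: B_def)
        moreover have "\<tau> l \<noteq> c" using C(2)[of l] l by auto
        ultimately show ?thesis using l \<tau>(1)[of l] by auto
      qed
      show "(f u div L - int c) div N = (f v div L - int c) div N"
        if uv: "u \<in> K c" "v \<in> K c" "d u v \<le> D" for u v
      proof -
        \<comment> \<open>Between adjacent blocks the quotient jumps only on entering a block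
          congruent to \<open>c\<close> modulo \<open>N\<close>, where colour \<open>c\<close> has
          no points.\<close>
        have step: "(a - int c) div N = (b - int c) div N"
          if "a \<le> b" "b \<le> a + 1" "b mod N \<noteq> int c" for a b
        proof (cases "b = a")
          case False
          then have b: "b = a + 1" using that by simp
          define q where "q = (b - int c) div N"
          define r where "r = (b - int c) mod N"
          have bq: "b - int c = q * N + r" by (simp add: q_def r_def)
          have r: "0 \<le> r" "r < N" using N by (auto simp: r_def)
          have "r \<noteq> 0"
          proof
            assume "r = 0"
            then have "b = int c + q * N" using bq by simp
            then have "b mod N = int c mod N" by simp
            also have "\<dots> = int c" using c by (simp add: N_def)
            finally show False using that by simp
          qed
          then have "a - int c = q * N + (r - 1)" "0 \<le> r - 1" "r - 1 < N" using bq b r by auto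
          then have "(a - int c) div N = q" 
            by (metis div_pos_pos_trivial div_mult_self3 add.commute add.right_neutral N less_irrefl)
          then show ?thesis by (simp add: q_def)
        qed simp
        have "\<bar>f u - f v\<bar> < L" using L0[of u v] K uv L by force
        then have "f u < f v + L" "f v < f u + L" by auto
        then have "f u div L \<le> (f v + L) div L" "f v div L \<le> (f u + L) div L"
          using L(1) by - (rule zdiv_mono1; linarith)+
        moreover have "(f w + L) div L = f w div L + 1" for w
          using L(1) by simp
        ultimately have "f u div L \<le> f v div L + 1" "f v div L \<le> f u div L + 1"
          by (simp_all only:)
        then show ?thesis
          using step[of "f u div L" "f v div L"] step[of "f v div L" "f u div L"] K uv
          by (metis linear)
      qed
      fix q
      \<comment> \<open>\<open>w j\<close> is the block of period \<open>q\<close> with residue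
        \<open>j\<close>, so the fibre has one block for each stage of the tower. At stage
        \<open>c\<close> the set \<open>C (w c) c\<close> is empty.\<close>
      define w where "w j = q * N + int c + (int j - int c) mod N" for j
      have "\<tau> (w j) = j" if "j \<le> Suc n" for j
      proof -
        have "w j mod N = (int c + (int j - int c) mod N) mod N"
          unfolding w_def by (metis add.assoc add.commute mod_mult_self3)
        also have "\<dots> = int j mod N" by (simp add: mod_simps)
        also have "\<dots> = int j" using that by (simp add: N_def)
        finally show ?thesis using \<tau>(1)[of "w j"] by simp
      qed
      then have w: "bounded_chains (s j) (\<rho> (s j)) (C (w j) c)" if "j \<le> Suc n" for j
        using C(3)[OF c, of "w j"] that by simp
      have "bounded_chains D (tower \<rho> D (Suc n)) (\<Union>j\<le>Suc n. C (w j) c)"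
        by (rule bounded_chains_tower[OF D \<rho> w[unfolded s_def]])
      moreover have "{u \<in> K c. (f u div L - int c) div N = q} \<subseteq> (\<Union>j\<le>Suc n. C (w j) c)"
      proof clarify
        fix u assume u: "u \<in> K c" "q = (f u div L - int c) div N"
        have "(int (\<tau> (f u div L)) - int c) mod N = (f u div L - int c) mod N"
          unfolding \<tau> by (simp add: mod_simps)
        then have "w (\<tau> (f u div L)) = f u div L"
          unfolding w_def using u(2) by (metis (no_types, lifting) add.assoc add.commute diff_add_cancel div_mult_mod_eq)
        then have "u \<in> C (w (\<tau> (f u div L))) c" using K u by simp
        then show "u \<in> (\<Union>j\<le>Suc n. C (w j) c)" using \<tau>(2) by blast
      qed
      ultimately show "bounded_chains D (tower \<rho> D (Suc n)) {u \<in> K c. (f u div L - int c) div N = q}"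
        by (rule bounded_chains_mono) auto
    qed
    then show ?thesis using X by blast
  qed
  \<comment> \<open>\<open>uniform_asdim_le\<close> ranges over all real scales; negative ones are
    reduced to scale 0.\<close>
  have "\<exists>R A. X = (\<Union>i\<le>Suc n. A i) \<and> (\<forall>i\<le>Suc n. bounded_chains D R (A i))" for D
    using nonneg[of "max D 0"] bounded_chains_mono by (meson max.cobounded1 max.cobounded2 order_refl)
  then show ?thesis by (simp add: uniform_asdim_le_singleton)
qed

end


section \<open>Finitely generated nilpotent groups are polycyclic\<close>

text \<open>Leaves the last term free, unlike \<open>polycyclic_series\<close>, so that a series can
  grow through subgroups.\<close>

definition series_upto :: "('a, 'b) monoid_scheme \<Rightarrow> nat \<Rightarrow> (nat \<Rightarrow> 'a set) \<Rightarrow> bool" where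
  "series_upto G n H \<longleftrightarrow>
     H 0 = {\<one>\<^bsub>G\<^esub>} \<and> (\<forall>i\<le>n. subgroup (H i) G) \<and>
     (\<forall>i<n. H i \<lhd> G\<lparr>carrier := H (Suc i)\<rparr> \<and> cyclic_group (series_factor G H i))"

definition polycyclic_subgroup :: "('a, 'b) monoid_scheme \<Rightarrow> 'a set \<Rightarrow> bool" where
  "polycyclic_subgroup G K \<longleftrightarrow> (\<exists>n H. series_upto G n H \<and> H n = K)"

declare lower_central_series.simps(2) [simp del]

context group
begin

section \<open>Building polycyclic series one generator at a time\<close>

lemma polycyclic_subgroup_one: "polycyclic_subgroup G {\<one>}"
  unfolding polycyclic_subgroup_def series_upto_def
  by (rule exI[of _ 0], rule exI[of _ "\<lambda>_. {\<one>}"]) (simp add: triv_subgroup)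

lemma polycyclic_subgroup_extend:
  assumes "polycyclic_subgroup G K" "subgroup K' G" "K \<lhd> G\<lparr>carrier := K'\<rparr>"
    and "cyclic_group (G\<lparr>carrier := K'\<rparr> Mod K)"
  shows "polycyclic_subgroup G K'"
proof -
  obtain n H where H: "series_upto G n H" "H n = K"
    using assms(1) unfolding polycyclic_subgroup_def by blast
  define H' where "H' = H(Suc n := K')"
  have "series_upto G (Suc n) H'"
    using H assms(2-4) unfolding series_upto_def H'_def series_factor_def
    by (auto simp: le_Suc_eq less_Suc_eq)
  moreover have "H' (Suc n) = K'" by (simp add: H'_def)
  ultimately show ?thesis unfolding polycyclic_subgroup_def by blast
qed

text \<open>The projection maps generators to generators and collapses \<open>N\<close> to the
  identity, so the coset of \<open>x\<close> alone generates the quotient.\<close>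

lemma cyclic_group_Mod:
  assumes N: "N \<lhd> G" and x: "x \<in> carrier G" and gen: "generate G (insert x N) = carrier G"
  shows "cyclic_group (G Mod N)"
proof -
  interpret N: normal N G by (rule N)
  interpret Q: group "G Mod N" by (rule N.factorgroup_is_group)
  interpret \<pi>: group_hom G "G Mod N" "\<lambda>a. N #> a"
    by (unfold_locales) (rule N.r_coset_hom_Mod)
  let ?C = "generate (G Mod N) {N #> x}"
  have "carrier (G Mod N) = (\<lambda>a. N #> a) ` generate G (insert x N)"
    by (simp add: gen carrier_FactGroup)
  also have "\<dots> = generate (G Mod N) ((\<lambda>a. N #> a) ` insert x N)"
    using x N.subset by (intro \<pi>.generate_img[symmetric]) auto
  also have "\<dots> \<subseteq> ?C"
  proof (rule Q.generate_subgroup_incl)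
    show "subgroup ?C (G Mod N)"
      using x by (intro Q.generate_is_subgroup) (auto simp: carrier_FactGroup)
    then have "N \<in> ?C"
      using subgroup.one_closed by fastforce
    moreover have "N #> a = N" if "a \<in> N" for a
      using that N.is_subgroup by (simp add: coset_join2 N.subset)
    ultimately show "(\<lambda>a. N #> a) ` insert x N \<subseteq> ?C"
      by (auto intro: generate.incl)
  qed
  finally have "carrier (G Mod N) \<subseteq> range (\<lambda>n::int. (N #> x) [^]\<^bsub>G Mod N\<^esub> n)"
    using x by (auto simp: Q.generate_pow \<pi>.hom_closed)
  moreover have "range (\<lambda>n::int. (N #> x) [^]\<^bsub>G Mod N\<^esub> n) \<subseteq> carrier (G Mod N)"
    using x by (auto intro: Q.int_pow_closed \<pi>.hom_closed)
  ultimately show ?thesis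
    unfolding Q.cyclic_group using x \<pi>.hom_closed by blast
qed

lemma polycyclic_subgroup_insert:
  assumes "polycyclic_subgroup G K" "K \<lhd> G" "x \<in> carrier G"
  shows "polycyclic_subgroup G (generate G (insert x K))"
proof -
  let ?K' = "generate G (insert x K)"
  have sub: "insert x K \<subseteq> carrier G"
    using assms normal_imp_subgroup subgroup.subset by blast
  have K': "subgroup ?K' G" "insert x K \<subseteq> ?K'"
    using generate_is_subgroup[OF sub] by (auto intro: generate.incl)
  have normal: "K \<lhd> G\<lparr>carrier := ?K'\<rparr>"
    using normal_restrict_supergroup[OF K'(1) assms(2)] K'(2) by blast
  interpret K': group "G\<lparr>carrier := ?K'\<rparr>"
    by (rule subgroup_imp_group[OF K'(1)])
  have "cyclic_group (G\<lparr>carrier := ?K'\<rparr> Mod K)"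
    using K' by (intro K'.cyclic_group_Mod[OF normal, of x]) (simp_all add: generate_consistent)
  then show ?thesis
    using polycyclic_subgroup_extend[OF assms(1) K'(1) normal] by blast
qed

text \<open>The elements of \<open>X\<close> are adjoined one by one, each giving a cyclic factor.
  The hypothesis \<open>normal\<close> makes every intermediate subgroup normal; between consecutive
  terms of the lower central series it holds.\<close>

lemma polycyclic_subgroup_generate:
  assumes "finite X" "X \<subseteq> carrier G" "polycyclic_subgroup G K" "subgroup K G"
    and normal: "\<And>L. subgroup L G \<Longrightarrow> K \<subseteq> L \<Longrightarrow> L \<subseteq> generate G (X \<union> K) \<Longrightarrow> L \<lhd> G"
  shows "polycyclic_subgroup G (generate G (X \<union> K))"
proof -
  have KG: "K \<subseteq> carrier G" using assms(4) by (rule subgroup.subset)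
  have "polycyclic_subgroup G (generate G (Y \<union> K))" if "finite Y" "Y \<subseteq> X" for Y
    using that
  proof (induction Y rule: finite_induct)
    case empty
    have "generate G K = K"
      using generateI[OF assms(4), of K] by blast
    then show ?case using assms(3) by simp
  next
    case (insert x Y)
    let ?L = "generate G (Y \<union> K)"
    have L: "subgroup ?L G" "Y \<union> K \<subseteq> ?L"
      using insert.prems assms(2) KG by (auto intro!: generate_is_subgroup intro: generate.incl)
    have "?L \<lhd> G"
    proof (rule normal)
      show "?L \<subseteq> generate G (X \<union> K)" using insert.prems by (intro mono_generate) auto
    qed (use L in auto)
    then have "polycyclic_subgroup G (generate G (insert x ?L))"
      using insert.IH insert.prems assms(2) by (intro polycyclic_subgroup_insert) auto
    moreover have "generate G (insert x ?L) = generate G (insert x Y \<union> K)"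
    proof
      have sub: "insert x Y \<union> K \<subseteq> carrier G" using insert.prems assms(2) KG by auto
      have "?L \<subseteq> generate G (insert x Y \<union> K)" by (rule mono_generate) auto
      then show "generate G (insert x ?L) \<subseteq> generate G (insert x Y \<union> K)"
        by (intro generate_subgroup_incl generate_is_subgroup[OF sub]) (simp add: generate.incl)
      show "generate G (insert x Y \<union> K) \<subseteq> generate G (insert x ?L)"
        using L(2) by (intro mono_generate) auto
    qed
    ultimately show ?case by simp
  qed
  from this[OF assms(1)] show ?thesis by simp
qed

section \<open>The lower central series\<close>

lemma commutator_closed_imp_normal:
  assumes "subgroup N G"
    and comm: "\<And>x y. x \<in> N \<Longrightarrow> y \<in> carrier G \<Longrightarrow> x \<otimes> y \<otimes> inv x \<otimes> inv y \<in> N"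
  shows "N \<lhd> G"
proof (rule normal_invI[OF assms(1)])
  fix y x assume y: "y \<in> carrier G" and x: "x \<in> N"
  have xG: "x \<in> carrier G" using assms(1) x by (rule subgroup.mem_carrier)
  \<comment> \<open>Conjugating \<open>x\<close> by \<open>y\<close> amounts to multiplying it on
    the left by the inverse of the commutator.\<close>
  have "inv (x \<otimes> y \<otimes> inv x \<otimes> inv y) \<otimes> x \<in> N"
    using comm[OF x y] x assms(1) by (simp add: subgroup.m_closed subgroup.m_inv_closed)
  also have "inv (x \<otimes> y \<otimes> inv x \<otimes> inv y) \<otimes> x = y \<otimes> x \<otimes> inv y"
    using xG y by (simp add: inv_mult_group m_assoc)
  finally show "y \<otimes> x \<otimes> inv y \<in> N" .
qed

lemma lower_central_series_commutator:
  "x \<in> lower_central_series G k \<Longrightarrow> y \<in> carrier G \<Longrightarrow>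
    x \<otimes> y \<otimes> inv x \<otimes> inv y \<in> lower_central_series G (Suc k)"
  unfolding lower_central_series.simps by (auto intro: generate.incl)

text \<open>The two claims feed each other: normality of a term puts its commutators back into it,
  and this inclusion places the commutators of the next term inside that next term, which is then
  normal.\<close>

lemma lower_central_series_normal:
  "lower_central_series G k \<lhd> G \<and> lower_central_series G (Suc k) \<subseteq> lower_central_series G k"
proof (induction k)
  have step: "lower_central_series G (Suc k) \<subseteq> lower_central_series G k"
    if N: "lower_central_series G k \<lhd> G" for k
  proof -
    have sub: "subgroup (lower_central_series G k) G" using N by (rule normal_imp_subgroup)
    have "x \<otimes> y \<otimes> inv x \<otimes> inv y \<in> lower_central_series G k"
      if "x \<in> lower_central_series G k" "y \<in> carrier G" for x y
    proof -
      have "x \<in> carrier G" using sub that by (simp add: subgroup.mem_carrier)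
      moreover have "x \<otimes> (y \<otimes> inv x \<otimes> inv y) \<in> lower_central_series G k"
        by (intro subgroup.m_closed[OF sub] that normal_invE(2)[OF N] subgroup.m_inv_closed[OF sub])
      ultimately show ?thesis using that by (simp add: m_assoc)
    qed
    then show ?thesis
      unfolding lower_central_series.simps by (intro generate_subgroup_incl sub) blast
  qed
  case 0
  have "carrier G \<lhd> G" by (rule normal_invI) (auto simp: subgroup_self)
  then show ?case using step[of 0] by simp
  case (Suc k)
  let ?\<gamma> = "lower_central_series G"
  have "?\<gamma> k \<subseteq> carrier G" using Suc normal_imp_subgroup subgroup.subset by blast
  then have sub: "subgroup (?\<gamma> (Suc k)) G"
    unfolding lower_central_series.simps by (intro generate_is_subgroup) blast
  then have "?\<gamma> (Suc k) \<lhd> G"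
  proof (rule commutator_closed_imp_normal)
    fix x y assume "x \<in> ?\<gamma> (Suc k)" "y \<in> carrier G"
    then show "x \<otimes> y \<otimes> inv x \<otimes> inv y \<in> ?\<gamma> (Suc k)"
      using Suc lower_central_series_commutator by blast
  qed
  then show ?case using step by blast
qed

text \<open>This is the preimage of the centralizer of \<open>q\<close>. Being a subgroup, it allows
  commutation modulo a normal subgroup to be checked on generators.\<close>

lemma subgroup_centralizer_hom:
  assumes "f \<in> hom G Q" "group Q" "q \<in> carrier Q"
  shows "subgroup {y \<in> carrier G. q \<otimes>\<^bsub>Q\<^esub> f y = f y \<otimes>\<^bsub>Q\<^esub> q} G"
proof -
  interpret f: group_hom G Q f
    using assms by (simp add: group_hom_def group_hom_axioms_def)
  show ?thesis
  proof
    fix y z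
    assume y: "y \<in> {y \<in> carrier G. q \<otimes>\<^bsub>Q\<^esub> f y = f y \<otimes>\<^bsub>Q\<^esub> q}"
      and z: "z \<in> {y \<in> carrier G. q \<otimes>\<^bsub>Q\<^esub> f y = f y \<otimes>\<^bsub>Q\<^esub> q}"
    then have "q \<otimes>\<^bsub>Q\<^esub> (f y \<otimes>\<^bsub>Q\<^esub> f z) = (f y \<otimes>\<^bsub>Q\<^esub> q) \<otimes>\<^bsub>Q\<^esub> f z"
      using assms(3) by (simp flip: f.H.m_assoc)
    also have "\<dots> = f y \<otimes>\<^bsub>Q\<^esub> f z \<otimes>\<^bsub>Q\<^esub> q"
      using y z assms(3) by (simp add: f.H.m_assoc)
    finally show "y \<otimes> z \<in> {y \<in> carrier G. q \<otimes>\<^bsub>Q\<^esub> f y = f y \<otimes>\<^bsub>Q\<^esub> q}"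
      using y z by simp
  next
    fix y assume y: "y \<in> {y \<in> carrier G. q \<otimes>\<^bsub>Q\<^esub> f y = f y \<otimes>\<^bsub>Q\<^esub> q}"
    then have fy: "f y \<in> carrier Q" "q \<otimes>\<^bsub>Q\<^esub> f y = f y \<otimes>\<^bsub>Q\<^esub> q" by auto
    have "inv\<^bsub>Q\<^esub> f y \<otimes>\<^bsub>Q\<^esub> q = inv\<^bsub>Q\<^esub> f y \<otimes>\<^bsub>Q\<^esub> (q \<otimes>\<^bsub>Q\<^esub> f y) \<otimes>\<^bsub>Q\<^esub> inv\<^bsub>Q\<^esub> f y"
      using fy(1) assms(3) by (simp add: f.H.m_assoc)
    also have "\<dots> = q \<otimes>\<^bsub>Q\<^esub> inv\<^bsub>Q\<^esub> f y"
      unfolding fy(2) using fy(1) assms(3) by (simp flip: f.H.m_assoc)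
    finally have "inv\<^bsub>Q\<^esub> f y \<otimes>\<^bsub>Q\<^esub> q = q \<otimes>\<^bsub>Q\<^esub> inv\<^bsub>Q\<^esub> f y" .
    then show "inv y \<in> {y \<in> carrier G. q \<otimes>\<^bsub>Q\<^esub> f y = f y \<otimes>\<^bsub>Q\<^esub> q}"
      using y by simp
  qed (use assms(3) in auto)
qed

text \<open>The commutator equals \<open>x \<otimes> y \<otimes> inv (y \<otimes> x)\<close>, so its
  membership in \<open>N\<close> compares the cosets of the two products.\<close>

lemma commutator_mem_iff:
  assumes "N \<lhd> G" "x \<in> carrier G" "y \<in> carrier G"
  shows "x \<otimes> y \<otimes> inv x \<otimes> inv y \<in> N \<longleftrightarrow>
    (N #> x) \<otimes>\<^bsub>G Mod N\<^esub> (N #> y) = (N #> y) \<otimes>\<^bsub>G Mod N\<^esub> (N #> x)"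
proof -
  interpret N: normal N G by (rule assms)
  have xy: "x \<otimes> y \<in> carrier G" "y \<otimes> x \<in> carrier G" "x \<otimes> y \<otimes> inv (y \<otimes> x) \<in> carrier G"
    using assms(2,3) by simp_all
  have "N #> (x \<otimes> y) = N #> (y \<otimes> x) \<longleftrightarrow> N #> (x \<otimes> y \<otimes> inv (y \<otimes> x)) = N"
    using coset_mult_inv1[OF _ xy(1,2) N.subset] coset_mult_inv2[OF _ xy(1,2) N.subset] by (rule iffI[rotated])
  also have "\<dots> \<longleftrightarrow> x \<otimes> y \<otimes> inv (y \<otimes> x) \<in> N"
    using coset_join1[OF _ xy(3) N.is_subgroup] coset_join2[OF xy(3) N.is_subgroup] by (rule iffI)
  finally have "N #> (x \<otimes> y) = N #> (y \<otimes> x) \<longleftrightarrow> x \<otimes> y \<otimes> inv (y \<otimes> x) \<in> N" .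
  then show ?thesis
    using assms(2,3) by (simp add: N.rcos_sum inv_mult_group m_assoc)
qed

text \<open>Modulo \<open>lower_central_series G (k + 2)\<close>, commutators of \<open>lower_central_series G k\<close> with \<open>G\<close> are
  central. Hence those of the generators \<open>X\<close> with \<open>S\<close> generate the next term.\<close>

lemma lower_central_series_generated:
  assumes "finite S" "S \<subseteq> carrier G" "generate G S = carrier G"
  shows "\<exists>X. finite X \<and> X \<subseteq> lower_central_series G k \<and>
    lower_central_series G k = generate G (X \<union> lower_central_series G (Suc k))"
proof (induction k)
  let ?\<gamma> = "lower_central_series G"
  have sub: "subgroup (?\<gamma> k) G" and le: "?\<gamma> (Suc k) \<subseteq> ?\<gamma> k" and \<gamma>G: "?\<gamma> k \<subseteq> carrier G" for k
    using lower_central_series_normal normal_imp_subgroup subgroup.subset by blast+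
  {
    case 0
    have "generate G (S \<union> ?\<gamma> (Suc 0)) = carrier G"
      using mono_generate[of S "S \<union> ?\<gamma> (Suc 0)"] generate_incl[of "S \<union> ?\<gamma> (Suc 0)"] \<gamma>G[of "Suc 0"] assms
      by (metis Un_least Un_upper1 subset_antisym)
    then show ?case using assms by (intro exI[of _ S]) simp
  next
    case (Suc k)
    from Suc.IH obtain X where X: "finite X" "X \<subseteq> ?\<gamma> k" "?\<gamma> k = generate G (X \<union> ?\<gamma> (Suc k))"
      by (elim exE conjE) (rule that)
    define Y where "Y = (\<lambda>(x, s). x \<otimes> s \<otimes> inv x \<otimes> inv s) ` (X \<times> S)"
    define N where "N = generate G (Y \<union> ?\<gamma> (Suc (Suc k)))"
    have "x \<otimes> s \<otimes> inv x \<otimes> inv s \<in> ?\<gamma> (Suc k)" if "x \<in> X" "s \<in> S" for x s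
      using that X(2) assms(2) by (intro lower_central_series_commutator) auto
    then have Y: "finite Y" "Y \<subseteq> ?\<gamma> (Suc k)"
      using X(1) assms(1) unfolding Y_def by auto
    have N1: "subgroup N G" "Y \<subseteq> N" "?\<gamma> (Suc (Suc k)) \<subseteq> N"
      using Y \<gamma>G unfolding N_def by (auto intro!: generate_is_subgroup intro: generate.incl)
    have N2: "N \<subseteq> ?\<gamma> (Suc k)"
      unfolding N_def using Y le by (intro generate_subgroup_incl sub) auto
    \<comment> \<open>\<open>N\<close> lies between two consecutive terms, so its commutators with
      \<open>G\<close> fall into the lower term and hence into \<open>N\<close>.\<close>
    have "N \<lhd> G"
      using N1 N2 lower_central_series_commutator by (intro commutator_closed_imp_normal) blast+
    then interpret N: normal N G .
    let ?Q = "G Mod N" and ?\<pi> = "\<lambda>a. N #> a"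
    note cent = subgroup_centralizer_hom[OF N.r_coset_hom_Mod N.factorgroup_is_group]
    have \<pi>: "?\<pi> a \<in> carrier ?Q" if "a \<in> carrier G" for a
      using that by (auto simp: carrier_FactGroup)
    \<comment> \<open>First pass: with \<open>x\<close> in \<open>X\<close> fixed, its centralizer
      modulo \<open>N\<close> contains \<open>S\<close> by the choice of \<open>Y\<close>, hence all
      of \<open>G\<close>.\<close>
    have XS: "?\<pi> x \<otimes>\<^bsub>?Q\<^esub> ?\<pi> y = ?\<pi> y \<otimes>\<^bsub>?Q\<^esub> ?\<pi> x" if x: "x \<in> X" and y: "y \<in> carrier G" for x y
    proof -
      have xG: "x \<in> carrier G" using x X(2) \<gamma>G by blast
      let ?C = "{y \<in> carrier G. ?\<pi> x \<otimes>\<^bsub>?Q\<^esub> ?\<pi> y = ?\<pi> y \<otimes>\<^bsub>?Q\<^esub> ?\<pi> x}"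
      have "S \<subseteq> ?C"
      proof
        fix s assume s: "s \<in> S"
        then have "x \<otimes> s \<otimes> inv x \<otimes> inv s \<in> N" using N1(2) x by (auto simp: Y_def)
        then show "s \<in> ?C" using commutator_mem_iff[OF \<open>N \<lhd> G\<close> xG] s assms(2) by auto
      qed
      then have "carrier G \<subseteq> ?C"
        using generate_subgroup_incl[OF _ cent[OF \<pi>[OF xG]]] by (simp only: assms(3)[symmetric])
      then show ?thesis using y by blast
    qed
    \<comment> \<open>Second pass: with \<open>y\<close> fixed, its centralizer modulo
      \<open>N\<close> contains \<open>X\<close> by the first pass, and
      \<open>?\<gamma> (Suc k)\<close> because the commutators of that term lie in
      \<open>N\<close>.\<close>
    have "x \<otimes> y \<otimes> inv x \<otimes> inv y \<in> N" if x: "x \<in> ?\<gamma> k" and y: "y \<in> carrier G" for x y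
    proof -
      let ?C = "{x \<in> carrier G. ?\<pi> y \<otimes>\<^bsub>?Q\<^esub> ?\<pi> x = ?\<pi> x \<otimes>\<^bsub>?Q\<^esub> ?\<pi> y}"
      have "X \<subseteq> ?C" using XS[OF _ y] X(2) \<gamma>G by fastforce
      moreover have "?\<gamma> (Suc k) \<subseteq> ?C"
      proof
        fix z assume z: "z \<in> ?\<gamma> (Suc k)"
        then have "z \<in> carrier G" using \<gamma>G by blast
        moreover have "z \<otimes> y \<otimes> inv z \<otimes> inv y \<in> N"
          using lower_central_series_commutator[OF z y] N1(3) by blast
        ultimately show "z \<in> ?C" using commutator_mem_iff[OF \<open>N \<lhd> G\<close>] y by auto
      qed
      ultimately have "?\<gamma> k \<subseteq> ?C"
        unfolding X(3) by (intro generate_subgroup_incl[OF _ cent[OF \<pi>[OF y]]]) blast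
      then show ?thesis using x y commutator_mem_iff[OF \<open>N \<lhd> G\<close>] by auto
    qed
    then have "?\<gamma> (Suc k) \<subseteq> N"
      unfolding lower_central_series.simps(2)[of G k] by (intro generate_subgroup_incl N1) blast
    then show ?case using N2 Y unfolding N_def by blast
  }
qed

lemma nilpotent_polycyclic_subgroup:
  assumes "finite S" "S \<subseteq> carrier G" "generate G S = carrier G"
    and "lower_central_series G c = {\<one>}"
  shows "polycyclic_subgroup G (carrier G)"
proof -
  let ?\<gamma> = "lower_central_series G"
  \<comment> \<open>Climbs from the trivial term \<open>c\<close> to the whole group; once
    \<open>j\<close> reaches \<open>c\<close>, the truncated difference stays 0.\<close>
  have "polycyclic_subgroup G (?\<gamma> (c - j))" for j
  proof (induction j)
    case 0
    then show ?case using assms(4) polycyclic_subgroup_one by simp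
  next
    case (Suc j)
    show ?case
    proof (cases "j < c")
      case True
      define k where "k = c - Suc j"
      have k: "c - j = Suc k" using True by (simp add: k_def)
      obtain X where X: "finite X" "X \<subseteq> ?\<gamma> k" "?\<gamma> k = generate G (X \<union> ?\<gamma> (Suc k))"
        using lower_central_series_generated[OF assms(1-3), of k] by (elim exE conjE) (rule that)
      have "polycyclic_subgroup G (generate G (X \<union> ?\<gamma> (Suc k)))"
      proof (rule polycyclic_subgroup_generate)
        show "polycyclic_subgroup G (?\<gamma> (Suc k))" using Suc k by simp
        show "X \<subseteq> carrier G" "subgroup (?\<gamma> (Suc k)) G"
          using X lower_central_series_normal normal_imp_subgroup subgroup.subset by blast+
        \<comment> \<open>Commutators of \<open>L\<close> with \<open>G\<close> lie in
          \<open>?\<gamma> (Suc k)\<close>, since \<open>L\<close> is inside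
          \<open>?\<gamma> k\<close>, and therefore in \<open>L\<close>.\<close>
        fix L assume L: "subgroup L G" "?\<gamma> (Suc k) \<subseteq> L" "L \<subseteq> generate G (X \<union> ?\<gamma> (Suc k))"
        then show "L \<lhd> G"
          using lower_central_series_commutator X(3) by (intro commutator_closed_imp_normal) blast+
      qed (rule X)
      then show ?thesis using X(3) k_def by metis
    next
      case False
      then show ?thesis using Suc by simp
    qed
  qed
  from this[of c] show ?thesis by simp
qed

end


section \<open>Extensions by cyclic groups\<close>

lemma (in group) infinite_cyclic_group_iso:
  assumes "cyclic_group G" "infinite (carrier G)"
  shows "G \<cong> integer_group"
proof -
  obtain x where x: "x \<in> carrier G" and gen: "subgroup_generated G {x} = G"
    using assms(1) unfolding cyclic_group_def by blast
  have "carrier G = range (\<lambda>n::int. x [^] n)"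
    using carrier_subgroup_generated_by_singleton[OF x] gen by simp
  moreover have "inj (\<lambda>n::int. x [^] n)"
    using infinite_cyclic_subgroup_int[OF x] gen assms(2) by (auto simp: inj_def)
  ultimately have "(\<lambda>n::int. x [^] n) \<in> iso integer_group G"
    using hom_integer_group_pow[OF x] by (simp add: iso_def bij_betw_def)
  then show ?thesis
    using group.iso_sym[OF group_integer_group] is_isoI by blast
qed

section \<open>Metric geometry of a group with a finite generating set\<close>

locale word_metric_group = group G for G (structure) +
  fixes S
  assumes finite_S: "finite S" and S_carrier: "S \<subseteq> carrier G" and generate_S: "generate G S = carrier G"
begin

sublocale Metric_space "carrier G" "word_dist G S"
  by (rule Metric_space_word_dist[OF S_carrier generate_S])

text \<open>Only finitely many words over a finite alphabet are that short. This will bound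
  integer-valued homomorphisms along short steps.\<close>

lemma finite_word_ball: "finite {g \<in> carrier G. real (word_length G S g) \<le> D}"
proof -
  let ?W = "{ws. set ws \<subseteq> S \<union> m_inv G ` S \<and> length ws \<le> nat \<lfloor>D\<rfloor>}"
  have "{g \<in> carrier G. real (word_length G S g) \<le> D} \<subseteq> word_value G ` ?W"
  proof clarify
    fix g assume g: "g \<in> carrier G" "real (word_length G S g) \<le> D"
    obtain ws where ws: "is_word G S ws" "word_value G ws = g" "length ws = word_length G S g"
      using word_length_attained[OF S_carrier, of g] g(1) generate_S by auto
    then have "ws \<in> ?W" using g(2) by (simp add: is_word_def le_nat_floor)
    then show "g \<in> word_value G ` ?W" using ws(2) by blast
  qed
  moreover have "finite ?W" using finite_S by (intro finite_lists_length_le) simp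
  ultimately show ?thesis using finite_surj by blast
qed

lemma word_dist_translate:
  assumes "a \<in> carrier G" "x \<in> carrier G" "y \<in> carrier G"
  shows "word_dist G S (a \<otimes> x) (a \<otimes> y) = word_dist G S x y"
proof -
  have "inv (a \<otimes> x) \<otimes> (a \<otimes> y) = inv x \<otimes> (inv a \<otimes> a) \<otimes> y"
    using assms by (simp only: inv_mult_group m_assoc inv_closed m_closed)
  then show ?thesis using assms by (simp add: word_dist_def)
qed

text \<open>Left translations are isometries, so one cover of \<open>X\<close> serves all translates
  with the same bound.\<close>

lemma uniform_asdim_le_translates:
  assumes "uniform_asdim_le {X} n"
  shows "uniform_asdim_le ((\<lambda>a. (\<otimes>) a ` X) ` carrier G) n"
  unfolding uniform_asdim_le_def
proof
  fix D
  obtain R A where A: "X = (\<Union>i\<le>n. A i)" "\<forall>i\<le>n. bounded_chains D R (A i)"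
    using assms[unfolded uniform_asdim_le_singleton, THEN spec, of D] by (elim exE conjE) (rule that)
  have "bounded_chains D R ((\<otimes>) a ` A i)" if a: "a \<in> carrier G" and i: "i \<le> n" for a i
  proof (rule bounded_chains_image)
    show "bounded_chains D R (A i)" using A(2) i by blast
    then have "A i \<subseteq> carrier G" by (simp add: bounded_chains_def)
    then show "(\<otimes>) a ` A i \<subseteq> carrier G"
      "\<And>x y. x \<in> A i \<Longrightarrow> y \<in> A i \<Longrightarrow> word_dist G S (a \<otimes> x) (a \<otimes> y) = word_dist G S x y"
      using a by (auto intro!: word_dist_translate)
  qed
  moreover have "(\<otimes>) a ` X = (\<Union>i\<le>n. (\<otimes>) a ` A i)" for a
    unfolding A(1) by (rule image_UN)
  ultimately show "\<exists>R. \<forall>Y\<in>(\<lambda>a. (\<otimes>) a ` X) ` carrier G.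
      \<exists>A. Y = (\<Union>i\<le>n. A i) \<and> (\<forall>i\<le>n. bounded_chains D R (A i))"
    by (intro exI[of _ R]) (metis (no_types, lifting) imageE)
qed

text \<open>Right multiplication by \<open>t\<close> moves every point by exactly the word length of
  \<open>t\<close>, so finitely many right translates of \<open>X\<close> stay in a bounded
  neighbourhood of \<open>X\<close>.\<close>

lemma uniform_asdim_le_finite_cosets:
  assumes X: "uniform_asdim_le {X} n" "X \<subseteq> carrier G" and T: "finite T" "T \<subseteq> carrier G"
    and Y: "Y \<subseteq> (\<Union>t\<in>T. X #> t)"
  shows "uniform_asdim_le {Y} n"
proof -
  obtain C where C: "\<And>t. t \<in> T \<Longrightarrow> word_length G S t \<le> C"
    using T(1) by (metis finite_imageI finite_nat_set_iff_bounded_le imageI)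
  have "Y \<subseteq> {y \<in> carrier G. \<exists>x\<in>X. word_dist G S x y \<le> real C}"
  proof
    fix y assume "y \<in> Y"
    then obtain t x where t: "t \<in> T" and x: "x \<in> X" "y = x \<otimes> t"
      using Y by (auto simp: r_coset_def)
    have tx: "t \<in> carrier G" "x \<in> carrier G" using t T x X by auto
    then have "word_dist G S x y = word_length G S t"
      using x by (simp add: word_dist_def flip: m_assoc)
    then show "y \<in> {y \<in> carrier G. \<exists>x\<in>X. word_dist G S x y \<le> real C}"
      using C[OF t] tx x by (auto intro!: bexI[of _ x])
  qed
  with X(1) show ?thesis by (rule uniform_asdim_le_thicken)
qed

text \<open>The blocks of \<open>f\<close> meet the demand of
  \<open>uniform_asdim_le_fibration\<close>: block 0 lies in the cosets of the kernel by the powers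
  of \<open>t\<close> with exponents from 0 to \<open>L - 1\<close>, and all other blocks are left
  translates of it.\<close>

lemma uniform_asdim_le_extension_int:
  fixes f :: "'a \<Rightarrow> int"
  assumes H: "subgroup H G"
    and f: "\<And>x y. x \<in> H \<Longrightarrow> y \<in> H \<Longrightarrow> f (x \<otimes> y) = f x + f y"
    and t: "t \<in> H" "f t = 1"
    and K: "uniform_asdim_le {{x \<in> H. f x = 0}} n"
  shows "uniform_asdim_le {H} (Suc n)"
proof (rule uniform_asdim_le_fibration)
  note H_closed = subgroup.m_closed[OF H] subgroup.m_inv_closed[OF H] subgroup.one_closed[OF H]
  note H_mem = subgroup.mem_carrier[OF H]
  show HG: "H \<subseteq> carrier G" by (rule subgroup.subset[OF H])
  have f_one: "f \<one> = 0" using f[of \<one> \<one>] H_closed by simp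
  have f_inv: "f (inv x) = - f x" if "x \<in> H" for x
    using f[of x "inv x"] that H_closed H_mem f_one by simp
  have pow: "t [^] m \<in> H \<and> f (t [^] m) = int m" for m :: nat
    by (induction m) (simp_all add: t f f_one H_closed)
  have int_pow: "t [^] z \<in> H \<and> f (t [^] z) = z" for z :: int
    using pow[of "nat z"] pow[of "nat (- z)"] f_inv H_closed by (simp add: int_pow_def2 del: pow_nat)
  show "\<exists>L. \<forall>x\<in>H. \<forall>y\<in>H. word_dist G S x y \<le> D \<longrightarrow> \<bar>f x - f y\<bar> \<le> L" for D
  proof -
    \<comment> \<open>For \<open>x\<close>, \<open>y\<close> in \<open>H\<close> the difference of
      the values is \<open>f\<close> at \<open>inv x \<otimes> y\<close> up to sign, and this
      element lies in a finite ball when the points are close.\<close>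
    let ?B = "(\<lambda>g. \<bar>f g\<bar>) ` {g \<in> carrier G. real (word_length G S g) \<le> D}"
    have "finite ?B" using finite_word_ball by (rule finite_imageI)
    then have "bdd_above ?B" by (rule bdd_above_finite)
    then obtain L where L: "\<forall>b\<in>?B. b \<le> L"
      unfolding bdd_above_def by (elim exE) (rule that)
    have "\<bar>f x - f y\<bar> \<le> L" if "x \<in> H" "y \<in> H" "word_dist G S x y \<le> D" for x y
    proof -
      have "\<bar>f (inv x \<otimes> y)\<bar> \<in> ?B"
        using that H_mem by (intro imageI) (simp add: word_dist_def)
      then have "\<bar>f (inv x \<otimes> y)\<bar> \<le> L" by (rule bspec[OF L])
      then show ?thesis using that f f_inv H_closed by simp
    qed
    then show ?thesis by blast
  qed
  fix L :: int assume L: "L > 0"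
  define B where "B = (\<lambda>l. {x \<in> H. f x div L = l})"
  have "uniform_asdim_le {B 0} n"
  proof (rule uniform_asdim_le_finite_cosets[OF K])
    show "{x \<in> H. f x = 0} \<subseteq> carrier G" using HG by blast
    show "finite ((\<lambda>m. t [^] m) ` {..<nat L})" by simp
    show "(\<lambda>m. t [^] m) ` {..<nat L} \<subseteq> carrier G" using pow H_mem by blast
    show "B 0 \<subseteq> (\<Union>s\<in>(\<lambda>m. t [^] m) ` {..<nat L}. {x \<in> H. f x = 0} #> s)"
    proof
      fix x assume "x \<in> B 0"
      then have x: "x \<in> H" "f x div L = 0" by (auto simp: B_def)
      have fx: "0 \<le> f x" "f x < L"
        using x(2) L div_mult_mod_eq[of "f x" L] pos_mod_sign[OF L, of "f x"] pos_mod_bound[OF L, of "f x"]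
        by auto
      then obtain m where "int m = f x" by (metis nonneg_int_cases)
      then have m: "t [^] m \<in> H" "f (t [^] m) = f x" "m < nat L"
        using pow[of m] fx by simp_all
      have "x \<otimes> inv (t [^] m) \<in> {x \<in> H. f x = 0}"
        using x m f f_inv H_closed by simp
      moreover have "x = x \<otimes> inv (t [^] m) \<otimes> t [^] m"
        using x(1) m(1) H_mem by (simp add: m_assoc)
      ultimately have "x \<in> {x \<in> H. f x = 0} #> t [^] m"
        unfolding r_coset_def by blast
      then show "x \<in> (\<Union>s\<in>(\<lambda>m. t [^] m) ` {..<nat L}. {x \<in> H. f x = 0} #> s)"
        using m(3) by blast
    qed
  qed
  then have translates: "uniform_asdim_le ((\<lambda>a. (\<otimes>) a ` B 0) ` carrier G) n"
    by (rule uniform_asdim_le_translates)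
  have "B l \<in> (\<lambda>a. (\<otimes>) a ` B 0) ` carrier G" for l
  proof
    \<comment> \<open>Left multiplication by this power adds \<open>l * L\<close> to
      \<open>f\<close>, which carries block 0 onto block \<open>l\<close>.\<close>
    define a where "a = t [^] (l * L)"
    have a: "a \<in> H" "f a = l * L" using int_pow by (auto simp: a_def)
    show "a \<in> carrier G" using a H_mem by blast
    show "B l = (\<otimes>) a ` B 0"
    proof
      show "(\<otimes>) a ` B 0 \<subseteq> B l"
        using a f H_closed L by (auto simp: B_def)
      show "B l \<subseteq> (\<otimes>) a ` B 0"
      proof
        fix x assume "x \<in> B l"
        then have x: "x \<in> H" "f x div L = l" by (auto simp: B_def)
        have "f (inv a \<otimes> x) = f x - l * L" using x a f f_inv H_closed by simp
        also have "\<dots> = f x mod L" using div_mult_mod_eq[of "f x" L] unfolding x(2) by linarith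
        finally have "inv a \<otimes> x \<in> B 0"
          using x a H_closed L by (simp add: B_def)
        moreover have "x = a \<otimes> (inv a \<otimes> x)"
          using x(1) a(1) H_mem by (simp flip: m_assoc)
        ultimately show "x \<in> (\<otimes>) a ` B 0" by blast
      qed
    qed
  qed
  then have "range B \<subseteq> (\<lambda>a. (\<otimes>) a ` B 0) ` carrier G" by (rule image_subsetI)
  with translates have "uniform_asdim_le (range B) n" by (rule uniform_asdim_le_subset)
  then show "uniform_asdim_le (range (\<lambda>l. {x \<in> H. f x div L = l})) n"
    unfolding B_def .
qed

text \<open>If the quotient is infinite cyclic, the projection followed by an isomorphism is an
  integer-valued homomorphism with kernel \<open>K\<close>. Otherwise the quotient is finite and
  \<open>H\<close> is a finite union of cosets of \<open>K\<close>.\<close>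

lemma uniform_asdim_le_cyclic_extension:
  assumes K: "K \<lhd> G\<lparr>carrier := H\<rparr>" and H: "subgroup H G"
    and Q: "cyclic_group (G\<lparr>carrier := H\<rparr> Mod K)" and n: "uniform_asdim_le {K} n"
  shows "uniform_asdim_le {H} (if (G\<lparr>carrier := H\<rparr> Mod K) \<cong> integer_group then Suc n else n)"
proof -
  let ?H = "G\<lparr>carrier := H\<rparr>"
  interpret H: group ?H by (rule subgroup_imp_group[OF H])
  interpret K: normal K ?H by (rule K)
  interpret Q: group "?H Mod K" by (rule K.factorgroup_is_group)
  let ?\<pi> = "\<lambda>x. K #>\<^bsub>?H\<^esub> x"
  have \<pi>_carrier: "carrier (?H Mod K) = ?\<pi> ` H" by (simp add: carrier_FactGroup)
  have \<pi>_eq: "x \<in> K #> y" if "x \<in> H" "?\<pi> x = ?\<pi> y" for x y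
  proof -
    have "x \<in> ?\<pi> x" using H.rcos_self[OF _ K.is_subgroup, of x] that(1) by simp
    then have "x \<in> ?\<pi> y" by (simp only: that(2))
    then show ?thesis by (simp add: r_coset_def)
  qed
  show ?thesis
  proof (cases "(?H Mod K) \<cong> integer_group")
    case True
    then obtain \<phi> where \<phi>: "\<phi> \<in> iso (?H Mod K) integer_group" by (auto simp: is_iso_def)
    then have \<phi>_hom: "\<phi> \<in> hom (?H Mod K) integer_group"
      and \<phi>_bij: "bij_betw \<phi> (carrier (?H Mod K)) UNIV"
      by (auto simp: iso_def)
    define f where "f x = \<phi> (?\<pi> x)" for x
    have "(\<lambda>x. \<phi> (?\<pi> x)) \<in> hom ?H integer_group"
      using Group.hom_compose[OF K.r_coset_hom_Mod \<phi>_hom] by (simp add: comp_def)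
    then have f: "f (x \<otimes> y) = f x + f y" if "x \<in> H" "y \<in> H" for x y
      using that by (simp add: hom_def f_def)
    obtain t where t: "t \<in> H" "f t = 1"
    proof -
      have "1 \<in> \<phi> ` ?\<pi> ` H" using \<phi>_bij \<pi>_carrier by (simp add: bij_betw_def)
      then show ?thesis using that unfolding f_def by auto
    qed
    have "x \<in> K \<longleftrightarrow> f x = 0" if x: "x \<in> H" for x
    proof -
      have "\<phi> K = 0" using hom_one[OF \<phi>_hom Q.is_group] by simp
      then have "f x = 0 \<longleftrightarrow> \<phi> (?\<pi> x) = \<phi> K" by (simp add: f_def)
      also have "\<dots> \<longleftrightarrow> ?\<pi> x = K"
        using \<phi>_bij x Q.one_closed \<pi>_carrier by (intro inj_on_eq_iff[of \<phi> "carrier (?H Mod K)"]) (auto simp: bij_betw_def)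
      also have "\<dots> \<longleftrightarrow> x \<in> K"
        using x H.coset_join1[OF _ _ K.is_subgroup, of x] H.coset_join2[OF _ K.is_subgroup, of x] by auto
      finally show ?thesis by simp
    qed
    moreover have "K \<subseteq> H" using K.subset by simp
    ultimately have "K = {x \<in> H. f x = 0}" by blast
    then show ?thesis
      using uniform_asdim_le_extension_int[OF H f t, of n] n True by simp
  next
    case False
    then have "finite (?\<pi> ` H)"
      using Q.infinite_cyclic_group_iso[OF Q] \<pi>_carrier by auto
    then obtain T where T: "T \<subseteq> H" "finite T" "?\<pi> ` H = ?\<pi> ` T"
      using finite_subset_image[of "?\<pi> ` H" ?\<pi> H] by blast
    have "uniform_asdim_le {H} n"
    proof (rule uniform_asdim_le_finite_cosets[OF n _ T(2)])
      show "K \<subseteq> carrier G" "T \<subseteq> carrier G"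
        using K.subset T(1) subgroup.subset[OF H] by auto
      show "H \<subseteq> (\<Union>t\<in>T. K #> t)"
      proof
        fix x assume x: "x \<in> H"
        then obtain s where "s \<in> T" "?\<pi> x = ?\<pi> s" using T(3) by blast
        then show "x \<in> (\<Union>t\<in>T. K #> t)" using \<pi>_eq[OF x] by blast
      qed
    qed
    then show ?thesis using False by simp
  qed
qed

text \<open>Holds for every polycyclic series, and so for whichever one the choice in
  \<open>hirsch_length\<close> selects. The induction truncates the count at \<open>i\<close>, where
  only the terms up to \<open>H i\<close> matter.\<close>

lemma asdim_le_polycyclic_series:
  assumes "polycyclic_series G n H"
  shows "asdim_le (infinite_cyclic_factors G n H)"
proof -
  have "uniform_asdim_le {H i} (infinite_cyclic_factors G i H)" if "i \<le> n" for i
    using that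
  proof (induction i)
    case 0
    have "word_dist G S \<one> y \<le> 0" if "(\<one>, y) \<in> (chain_step D {\<one>})\<^sup>*" for D y
    proof -
      have "y = \<one>" using chain_step_rtrancl_mem[OF that] by simp
      then show ?thesis using zero[of \<one> \<one>] by simp
    qed
    then have "bounded_chains D 0 {\<one>}" for D
      by (auto simp: bounded_chains_def)
    then have "uniform_asdim_le {{\<one>}} 0"
      unfolding uniform_asdim_le_singleton by (intro allI exI[of _ 0] exI[of _ "\<lambda>_. {\<one>}"]) simp
    then show ?case using assms by (simp add: polycyclic_series_def infinite_cyclic_factors_def)
  next
    case (Suc i)
    let ?Z = "\<lambda>i. {j. j < i \<and> series_factor G H j \<cong> integer_group}"
    have "uniform_asdim_le {H (Suc i)} (if series_factor G H i \<cong> integer_group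
        then Suc (infinite_cyclic_factors G i H) else infinite_cyclic_factors G i H)"
      using assms Suc unfolding series_factor_def polycyclic_series_def
      by (intro uniform_asdim_le_cyclic_extension) simp_all
    moreover have "?Z (Suc i) = (if series_factor G H i \<cong> integer_group then insert i (?Z i) else ?Z i)"
      by (auto simp: less_Suc_eq)
    ultimately show ?case by (simp add: infinite_cyclic_factors_def split: if_splits)
  qed
  from this[of n] show ?thesis
    using assms by (intro asdim_leI) (simp add: polycyclic_series_def)
qed

end

theorem corollary9:
  fixes G :: "('a, 'b) monoid_scheme" and S :: "'a set"
  assumes "nilpotent_group G"
    and "finite S" and "S \<subseteq> carrier G" and "generate G S = carrier G"
  shows "Metric_space.asdim (carrier G) (word_dist G S) \<le> enat (hirsch_length G)"
proof -
  obtain c where G: "group G" and c: "lower_central_series G c = {\<one>\<^bsub>G\<^esub>}"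
    using assms(1) unfolding nilpotent_group_def by blast
  interpret word_metric_group G S
    using G assms by (simp add: word_metric_group_def word_metric_group_axioms_def)
  have "polycyclic_subgroup G (carrier G)"
    by (rule nilpotent_polycyclic_subgroup[OF assms(2-4) c])
  \<comment> \<open>A polycyclic series exists, so the choice operator returns the count of an
    actual series.\<close>
  then have "\<exists>h n H. polycyclic_series G n H \<and> h = infinite_cyclic_factors G n H"
    unfolding polycyclic_subgroup_def series_upto_def polycyclic_series_def by blast
  then have "\<exists>n H. polycyclic_series G n H \<and> hirsch_length G = infinite_cyclic_factors G n H"
    unfolding hirsch_length_def by (rule someI_ex)
  then have "asdim_le (hirsch_length G)"
    using asdim_le_polycyclic_series by auto
  then show ?thesis
    unfolding asdim_def by (intro INF_lower) simp
qed

end
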